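(* Let $(V^\bullet,\diamond,\pi)$ be a weak comp algebra over a field $k$. Then $V^\bullet$ is a cochain complex with the coboundary $d:V^m\to V^{m+1}$, $$df=(-1)^{m-1}\pi\diamond f-f\diamond\pi\qquad(f\in V^m).$$ Furthermore, $d$ is a degree one derivation in both algebras $(V,\cup)$ and $(V,\sqcup)$, where $V=\bigoplus_{i\geq 0}V^i$; that is, for all $f\in V^m$, $g\in V^n$, $d(f\cup g)=df\cup g+(-1)^mf\cup dg$ and $d(f\sqcup g)=df\sqcup g+(-1)^mf\sqcup dg$.
   Context: A (right) weak comp algebra $(V^\bullet,\diamond,\pi)$ over a field $k$ consists of a sequence of vector spaces $V^0,V^1,V^2,\ldots$, an element $\pi\in V^2$ and $k$-linear operations $\diamond_i:V^m\otimes V^n\to V^{m+n-1}$ for $i\ge0$ (with $V^{-1}=0$ understood) such that for any $f\in V^m$, $g\in V^n$, $h\in V^p$: (1) $f\diamond_ig=0$ if $i>m-1$; (2) $(f\diamond_ig)\diamond_jh=f\diamond_i(g\diamond_{j-i}h)$ if $i\le j<n+i$; (3) if either $g=\pi$ or $h=\pi$, then $(f\diamond_ig)\diamond_jh=(f\diamond_jh)\diamond_{i+p-1}g$ if $j<i$; (4) $\pi\diamond_0\pi=\pi\diamond_1\pi$. For $f\in V^m$, $g\in V^n$ one sets $$f\diamond g=\sum_{i=0}^{m-1}(-1)^{i(n-1)}f\diamond_ig\in V^{m+n-1},\qquad f\cup g=(\pi\diamond_0f)\diamond_mg,\qquad f\sqcup g=(\pi\diamond_1g)\diamond_0f .$$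 *)

theory Defs
  imports "HOL-Algebra.Module"
begin

text \<open>A graded vector space is a family \<open>V :: int \<Rightarrow> ('k, 'v) module\<close> of modules over a field \<open>K\<close>
  (the ring multiplication and unit fields of the \<open>module\<close> record play no role).
  The data are the spaces \<open>V n\<close> with \<open>n \<ge> 0\<close>; indexing by the integers, with \<open>V n = 0\<close> for
  \<open>n < 0\<close>, realises the convention \<open>V\<^sup>-\<^sup>1 = 0\<close> and avoids truncated subtraction in the
  degree \<open>m + n - 1\<close>.
  An operation on graded spaces carries the degrees of its arguments explicitly, since
  the carriers of the \<open>V n\<close>, all subsets of one type, need not be disjoint.\<close>

definition linear_map ::
  "('k, 'a) ring_scheme \<Rightarrow> ('k, 'v, 'b) module_scheme \<Rightarrow> ('k, 'w, 'c) module_scheme \<Rightarrow> ('v \<Rightarrow> 'w) \<Rightarrow> bool"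
  where "linear_map K M N h \<longleftrightarrow>
    h \<in> carrier M \<rightarrow> carrier N \<and>
    (\<forall>x\<in>carrier M. \<forall>y\<in>carrier M. h (x \<oplus>\<^bsub>M\<^esub> y) = h x \<oplus>\<^bsub>N\<^esub> h y) \<and>
    (\<forall>a\<in>carrier K. \<forall>x\<in>carrier M. h (a \<odot>\<^bsub>M\<^esub> x) = a \<odot>\<^bsub>N\<^esub> h x)"

text \<open>A linear map \<open>M \<otimes> N \<rightarrow> P\<close> is given as a bilinear map.\<close>

definition bilinear_map ::
  "('k, 'a) ring_scheme \<Rightarrow> ('k, 'v, 'b) module_scheme \<Rightarrow> ('k, 'w, 'c) module_scheme \<Rightarrow>
    ('k, 'u, 'd) module_scheme \<Rightarrow> ('v \<Rightarrow> 'w \<Rightarrow> 'u) \<Rightarrow> bool"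
  where "bilinear_map K M N P b \<longleftrightarrow>
    (\<forall>x\<in>carrier M. linear_map K N P (\<lambda>y. b x y)) \<and>
    (\<forall>y\<in>carrier N. linear_map K M P (\<lambda>x. b x y))"

text \<open>\<open>cmp m n i f g\<close> is \<open>f \<diamond>\<^sub>i g\<close> for \<open>f \<in> V\<^sup>m\<close>, \<open>g \<in> V\<^sup>n\<close>. Since elements of different degrees
  may coincide as elements of the type \<open>'v\<close>, the condition \<open>g = \<pi>\<close> includes \<open>n = 2\<close>.\<close>

locale weak_comp_algebra =
  fixes K :: "('k, 'a) ring_scheme"
    and V :: "int \<Rightarrow> ('k, 'v, 'b) module_scheme"
    and cmp :: "int \<Rightarrow> int \<Rightarrow> int \<Rightarrow> 'v \<Rightarrow> 'v \<Rightarrow> 'v"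
    and \<pi> :: 'v
  assumes base_field: "field K"
    and vector_space: "\<And>n. module K (V n)"
    and negative_degree: "\<And>n. n < 0 \<Longrightarrow> carrier (V n) = {\<zero>\<^bsub>V n\<^esub>}"
    and pi_closed: "\<pi> \<in> carrier (V 2)"
    and comp_bilinear: "\<And>m n i. 0 \<le> i \<Longrightarrow>
      bilinear_map K (V m) (V n) (V (m + n - 1)) (cmp m n i)"
    and comp_vanish: "\<And>m n i f g.
      \<lbrakk>0 \<le> m; 0 \<le> n; 0 \<le> i; f \<in> carrier (V m); g \<in> carrier (V n); i > m - 1\<rbrakk> \<Longrightarrow>
      cmp m n i f g = \<zero>\<^bsub>V (m + n - 1)\<^esub>"
    and comp_nested: "\<And>m n p i j f g h.
      \<lbrakk>0 \<le> m; 0 \<le> n; 0 \<le> p; 0 \<le> i; f \<in> carrier (V m); g \<in> carrier (V n); h \<in> carrier (V p);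
       i \<le> j; j < n + i\<rbrakk> \<Longrightarrow>
      cmp (m + n - 1) p j (cmp m n i f g) h = cmp m (n + p - 1) i f (cmp n p (j - i) g h)"
    and comp_disjoint: "\<And>m n p i j f g h.
      \<lbrakk>0 \<le> m; 0 \<le> n; 0 \<le> p; 0 \<le> j; f \<in> carrier (V m); g \<in> carrier (V n); h \<in> carrier (V p);
       n = 2 \<and> g = \<pi> \<or> p = 2 \<and> h = \<pi>; j < i\<rbrakk> \<Longrightarrow>
      cmp (m + n - 1) p j (cmp m n i f g) h =
      cmp (m + p - 1) n (i + p - 1) (cmp m p j f h) g"
    and pi_assoc: "cmp 2 2 0 \<pi> \<pi> = cmp 2 2 1 \<pi> \<pi>"

text \<open>\<open>signed M e x\<close> is \<open>(-1)\<^sup>e x\<close>; the integer exponent \<open>e\<close> may be negative.\<close>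

definition signed :: "('v, 'a) ring_scheme \<Rightarrow> int \<Rightarrow> 'v \<Rightarrow> 'v"
  where "signed M e x = (if even e then x else \<ominus>\<^bsub>M\<^esub> x)"

definition diamond ::
  "(int \<Rightarrow> ('k, 'v, 'b) module_scheme) \<Rightarrow> (int \<Rightarrow> int \<Rightarrow> int \<Rightarrow> 'v \<Rightarrow> 'v \<Rightarrow> 'v) \<Rightarrow>
    int \<Rightarrow> int \<Rightarrow> 'v \<Rightarrow> 'v \<Rightarrow> 'v"
  where "diamond V cmp m n f g =
    (\<Oplus>\<^bsub>V (m + n - 1)\<^esub> i \<in> {0..m - 1}. signed (V (m + n - 1)) (i * (n - 1)) (cmp m n i f g))"

definition cup :: "(int \<Rightarrow> int \<Rightarrow> int \<Rightarrow> 'v \<Rightarrow> 'v \<Rightarrow> 'v) \<Rightarrow> 'v \<Rightarrow> int \<Rightarrow> int \<Rightarrow> 'v \<Rightarrow> 'v \<Rightarrow> 'v"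
  where "cup cmp \<pi> m n f g = cmp (m + 1) n m (cmp 2 m 0 \<pi> f) g"

definition sqcup :: "(int \<Rightarrow> int \<Rightarrow> int \<Rightarrow> 'v \<Rightarrow> 'v \<Rightarrow> 'v) \<Rightarrow> 'v \<Rightarrow> int \<Rightarrow> int \<Rightarrow> 'v \<Rightarrow> 'v \<Rightarrow> 'v"
  where "sqcup cmp \<pi> m n f g = cmp (n + 1) m 0 (cmp 2 n 1 \<pi> g) f"

definition coboundary ::
  "(int \<Rightarrow> ('k, 'v, 'b) module_scheme) \<Rightarrow> (int \<Rightarrow> int \<Rightarrow> int \<Rightarrow> 'v \<Rightarrow> 'v \<Rightarrow> 'v) \<Rightarrow> 'v \<Rightarrow>
    int \<Rightarrow> 'v \<Rightarrow> 'v"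
  where "coboundary V cmp \<pi> m f =
    signed (V (m + 1)) (m - 1) (diamond V cmp 2 m \<pi> f) \<ominus>\<^bsub>V (m + 1)\<^esub> diamond V cmp m 2 f \<pi>"

definition cochain_complex ::
  "('k, 'a) ring_scheme \<Rightarrow> (int \<Rightarrow> ('k, 'v, 'b) module_scheme) \<Rightarrow> (int \<Rightarrow> 'v \<Rightarrow> 'v) \<Rightarrow> bool"
  where "cochain_complex K V d \<longleftrightarrow>
    (\<forall>m\<ge>0. linear_map K (V m) (V (m + 1)) (d m)) \<and>
    (\<forall>m\<ge>0. \<forall>f\<in>carrier (V m). d (m + 1) (d m f) = \<zero>\<^bsub>V (m + 2)\<^esub>)"

text \<open>A not necessarily associative or unital graded algebra structure on \<open>\<Oplus>\<^sub>m\<^sub>\<ge>\<^sub>0 V\<^sup>m\<close>, given by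
  the restrictions \<open>V\<^sup>m \<times> V\<^sup>n \<rightarrow> V\<^sup>m\<^sup>+\<^sup>n\<close> of the product to homogeneous components.\<close>

definition graded_algebra ::
  "('k, 'a) ring_scheme \<Rightarrow> (int \<Rightarrow> ('k, 'v, 'b) module_scheme) \<Rightarrow>
    (int \<Rightarrow> int \<Rightarrow> 'v \<Rightarrow> 'v \<Rightarrow> 'v) \<Rightarrow> bool"
  where "graded_algebra K V mlt \<longleftrightarrow>
    (\<forall>m\<ge>0. \<forall>n\<ge>0. bilinear_map K (V m) (V n) (V (m + n)) (mlt m n))"

definition degree_one_derivation ::
  "('k, 'a) ring_scheme \<Rightarrow> (int \<Rightarrow> ('k, 'v, 'b) module_scheme) \<Rightarrow>
    (int \<Rightarrow> int \<Rightarrow> 'v \<Rightarrow> 'v \<Rightarrow> 'v) \<Rightarrow> (int \<Rightarrow> 'v \<Rightarrow> 'v) \<Rightarrow> bool"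
  where "degree_one_derivation K V mlt d \<longleftrightarrow>
    (\<forall>m\<ge>0. linear_map K (V m) (V (m + 1)) (d m)) \<and>
    (\<forall>m\<ge>0. \<forall>n\<ge>0. \<forall>f\<in>carrier (V m). \<forall>g\<in>carrier (V n).
      d (m + n) (mlt m n f g) =
      mlt (m + 1) n (d m f) g \<oplus>\<^bsub>V (m + n + 1)\<^esub>
      signed (V (m + n + 1)) m (mlt m (n + 1) f (d n g)))"

end

theory Submission
  imports Defs
begin

text \<open>The coboundary is the alternating sum \<open>d f = \<Sum>\<^sub>k (-1)\<^sup>k \<partial>\<^sub>k f\<close>, \<open>0 \<le> k \<le> m + 1\<close>, of the faces
  \<open>\<partial>\<^sub>0 f = \<pi> \<diamond>\<^sub>1 f\<close>, \<open>\<partial>\<^sub>k f = f \<diamond>\<^sub>k\<^sub>-\<^sub>1 \<pi>\<close> for \<open>1 \<le> k \<le> m\<close> and \<open>\<partial>\<^sub>m\<^sub>+\<^sub>1 f = \<pi> \<diamond>\<^sub>0 f\<close>.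
  The axioms give the cosimplicial identities \<open>\<partial>\<^sub>j \<partial>\<^sub>i = \<partial>\<^sub>i \<partial>\<^sub>j\<^sub>-\<^sub>1\<close> for \<open>i < j\<close>, whence \<open>d \<circ> d = 0\<close>.
  For either product \<open>f \<cdot> g\<close> the faces \<open>\<partial>\<^sub>k\<close> with \<open>k \<le> m\<close> act on \<open>f\<close> alone and the faces \<open>\<partial>\<^sub>m\<^sub>+\<^sub>k\<close> with
  \<open>k \<ge> 1\<close> act as \<open>\<partial>\<^sub>k\<close> on \<open>g\<close> alone; in the Leibniz sum the two remaining terms
  \<open>\<partial>\<^sub>m\<^sub>+\<^sub>1 f \<cdot> g = f \<cdot> \<partial>\<^sub>0 g\<close> come with opposite signs.\<close>

section \<open>Alternating sums in abelian groups\<close>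

text \<open>The indices are natural numbers so that sums can be treated by induction, whereas
  degrees are integers; a degree \<open>m \<ge> 0\<close> is therefore written as
  \<open>int n\<close> wherever such a sum enters.\<close>

definition alt_sum :: "('v, 'a) ring_scheme \<Rightarrow> nat \<Rightarrow> (nat \<Rightarrow> 'v) \<Rightarrow> 'v"
  where "alt_sum M n x = (\<Oplus>\<^bsub>M\<^esub> k \<in> {..n}. signed M (int k) (x k))"

context abelian_group
begin

lemma signed_closed [simp, intro]: "x \<in> carrier G \<Longrightarrow> signed G e x \<in> carrier G"
  by (simp add: signed_def)

lemma signed_signed: "x \<in> carrier G \<Longrightarrow> signed G e (signed G e' x) = signed G (e + e') x"
  by (auto simp: signed_def)

lemma signed_add:
  "x \<in> carrier G \<Longrightarrow> y \<in> carrier G \<Longrightarrow> signed G e (x \<oplus> y) = signed G e x \<oplus> signed G e y"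
  by (simp add: signed_def minus_add)

lemma signed_cancel:
  assumes "odd (e + e')" "x \<in> carrier G"
  shows "signed G e x \<oplus> signed G e' x = \<zero>"
  using assms by (auto simp: signed_def l_neg r_neg)

lemma alt_sum_0: "x 0 \<in> carrier G \<Longrightarrow> alt_sum G 0 x = x 0"
  by (simp add: alt_sum_def signed_def)

lemma alt_sum_Suc:
  assumes "\<And>k. k \<le> Suc n \<Longrightarrow> x k \<in> carrier G"
  shows "alt_sum G (Suc n) x = alt_sum G n x \<oplus> signed G (int (Suc n)) (x (Suc n))"
proof -
  have "alt_sum G (Suc n) x = signed G (int (Suc n)) (x (Suc n)) \<oplus> alt_sum G n x"
    unfolding alt_sum_def using assms by (subst finsum_Suc) auto
  moreover have "alt_sum G n x \<in> carrier G"
    unfolding alt_sum_def using assms by (intro finsum_closed) auto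
  ultimately show ?thesis using assms by (simp add: a_comm)
qed

lemma alt_sum_closed [intro]:
  "(\<And>k. k \<le> n \<Longrightarrow> x k \<in> carrier G) \<Longrightarrow> alt_sum G n x \<in> carrier G"
  unfolding alt_sum_def by (intro finsum_closed) auto

lemma alt_sum_cong:
  assumes "\<And>k. k \<le> n \<Longrightarrow> x k = y k" "\<And>k. k \<le> n \<Longrightarrow> y k \<in> carrier G"
  shows "alt_sum G n x = alt_sum G n y"
  unfolding alt_sum_def using assms by (intro finsum_cong') auto

lemma alt_sum_add:
  assumes "\<And>k. k \<le> n \<Longrightarrow> x k \<in> carrier G" "\<And>k. k \<le> n \<Longrightarrow> y k \<in> carrier G"
  shows "alt_sum G n (\<lambda>k. x k \<oplus> y k) = alt_sum G n x \<oplus> alt_sum G n y"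
proof -
  have "alt_sum G n (\<lambda>k. x k \<oplus> y k)
      = (\<Oplus>k\<in>{..n}. signed G (int k) (x k) \<oplus> signed G (int k) (y k))"
    unfolding alt_sum_def using assms by (intro finsum_cong') (auto simp: signed_add)
  also have "\<dots> = alt_sum G n x \<oplus> alt_sum G n y"
    unfolding alt_sum_def using assms by (intro finsum_addf) auto
  finally show ?thesis .
qed

lemma alt_sum_signed:
  assumes "\<And>k. k \<le> n \<Longrightarrow> x k \<in> carrier G"
  shows "alt_sum G n (\<lambda>k. signed G e (x k)) = signed G e (alt_sum G n x)"
  using assms
proof (induction n)
  case 0
  then show ?case by (simp add: alt_sum_0)
next
  case (Suc n)
  then show ?case
    by (simp add: alt_sum_Suc alt_sum_closed signed_add signed_signed add.commute)
qed

text \<open>Passing from \<open>n\<close> to \<open>n + 1\<close> adds a row and a column, which cancel by the hypothesis.\<close>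

lemma alt_sum_alt_sum_zero:
  assumes "\<And>i j. i \<le> n \<Longrightarrow> j \<le> Suc n \<Longrightarrow> x j i \<in> carrier G"
    and "\<And>i j. i < j \<Longrightarrow> j \<le> Suc n \<Longrightarrow> x j i = x i (j - 1)"
  shows "alt_sum G (Suc n) (\<lambda>j. alt_sum G n (x j)) = \<zero>"
  using assms
proof (induction n)
  case 0
  have "x (Suc 0) 0 = x 0 0" using "0.prems"(2)[of 0 1] by simp
  then show ?case
    using "0.prems"(1) by (simp add: alt_sum_Suc alt_sum_0 signed_def r_neg)
next
  case (Suc n)
  have c [simp]: "i \<le> Suc n \<Longrightarrow> j \<le> Suc (Suc n) \<Longrightarrow> x j i \<in> carrier G" for i j
    using Suc.prems(1) by blast
  \<comment> \<open>At \<open>j = n + 2\<close> the hypothesis turns the new row into the new column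
    \<open>i = n + 1\<close>; they enter with the opposite signs (-1)^(n+2) and (-1)^(n+1).\<close>
  have row: "alt_sum G (Suc n) (x (Suc (Suc n))) = alt_sum G (Suc n) (\<lambda>j. x j (Suc n))"
    using Suc.prems(2)[of _ "Suc (Suc n)"] by (intro alt_sum_cong) auto
  have "alt_sum G (Suc n) (\<lambda>j. alt_sum G (Suc n) (x j))
      = alt_sum G (Suc n) (\<lambda>j. alt_sum G n (x j) \<oplus> signed G (int (Suc n)) (x j (Suc n)))"
    by (intro alt_sum_cong) (auto simp: alt_sum_Suc intro!: alt_sum_closed)
  also have "\<dots> = alt_sum G (Suc n) (\<lambda>j. alt_sum G n (x j))
      \<oplus> signed G (int (Suc n)) (alt_sum G (Suc n) (\<lambda>j. x j (Suc n)))"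
    by (subst alt_sum_add) (auto intro!: alt_sum_closed simp: alt_sum_signed)
  also have "alt_sum G (Suc n) (\<lambda>j. alt_sum G n (x j)) = \<zero>"
    using Suc.prems by (intro Suc.IH) auto
  finally have "alt_sum G (Suc n) (\<lambda>j. alt_sum G (Suc n) (x j))
      = signed G (int (Suc n)) (alt_sum G (Suc n) (\<lambda>j. x j (Suc n)))"
    by (simp add: alt_sum_closed)
  moreover have "alt_sum G (Suc (Suc n)) (\<lambda>j. alt_sum G (Suc n) (x j))
      = alt_sum G (Suc n) (\<lambda>j. alt_sum G (Suc n) (x j))
        \<oplus> signed G (int (Suc (Suc n))) (alt_sum G (Suc n) (x (Suc (Suc n))))"
    by (intro alt_sum_Suc alt_sum_closed) auto
  ultimately show ?case
    by (simp add: row signed_cancel alt_sum_closed del: of_nat_Suc)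
qed

text \<open>The equal elements \<open>b (Suc m)\<close> and \<open>c 0\<close> carry the signs
  (-1)^(m+1) and (-1)^m and cancel; the other terms on the right are exactly those of
  \<open>a\<close>. In the Leibniz rule, \<open>b\<close> collects the faces of the first factor and
  \<open>c\<close> those of the second. The cancellation is the base case of an induction on
  \<open>n\<close>.\<close>

lemma alt_sum_glue:
  assumes "\<And>k. k \<le> m \<Longrightarrow> a k = b k" "\<And>k. 1 \<le> k \<Longrightarrow> k \<le> n \<Longrightarrow> a (m + k) = c k"
    and b: "\<And>k. k \<le> Suc m \<Longrightarrow> b k \<in> carrier G" and c: "\<And>k. k \<le> n \<Longrightarrow> c k \<in> carrier G"
    and bc: "b (Suc m) = c 0"
  shows "alt_sum G (m + n) a = alt_sum G (Suc m) b \<oplus> signed G (int m) (alt_sum G n c)"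
  using assms(2) c
proof (induction n)
  case 0
  have "alt_sum G (Suc m) b \<oplus> signed G (int m) (alt_sum G 0 c)
      = alt_sum G m b \<oplus> (signed G (int (Suc m)) (c 0) \<oplus> signed G (int m) (c 0))"
    using b bc 0 by (simp add: alt_sum_0 alt_sum_Suc a_assoc alt_sum_closed)
  also have "\<dots> = alt_sum G m b"
    using b 0 by (subst signed_cancel) (auto intro!: r_zero alt_sum_closed)
  also have "\<dots> = alt_sum G m a"
    using assms(1) b by (intro alt_sum_cong[symmetric]) auto
  finally show ?case by simp
next
  case (Suc n)
  have a: "a k \<in> carrier G" if "k \<le> Suc (m + n)" for k
  proof (cases "k \<le> m")
    case True
    then show ?thesis using assms(1) b by simp
  next
    case False
    then show ?thesis using Suc.prems(1)[of "k - m"] Suc.prems(2)[of "k - m"] that by simp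
  qed
  have IH: "alt_sum G (m + n) a = alt_sum G (Suc m) b \<oplus> signed G (int m) (alt_sum G n c)"
    using Suc.prems by (intro Suc.IH) auto
  have "alt_sum G (m + Suc n) a = alt_sum G (m + n) a \<oplus> signed G (int (Suc (m + n))) (a (Suc (m + n)))"
    unfolding add_Suc_right using a by (rule alt_sum_Suc)
  also have "a (Suc (m + n)) = c (Suc n)"
    using Suc.prems(1)[of "Suc n"] by simp
  also have "alt_sum G (m + n) a \<oplus> signed G (int (Suc (m + n))) (c (Suc n))
      = alt_sum G (Suc m) b \<oplus> signed G (int m) (alt_sum G (Suc n) c)"
  proof -
    have "alt_sum G (Suc n) c = alt_sum G n c \<oplus> signed G (int (Suc n)) (c (Suc n))"
      using Suc.prems(2) by (rule alt_sum_Suc)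
    moreover have "alt_sum G n c \<in> carrier G" "alt_sum G (Suc m) b \<in> carrier G" "c (Suc n) \<in> carrier G"
      using Suc.prems(2) b by (auto intro!: alt_sum_closed)
    ultimately show ?thesis
      by (simp add: IH signed_add signed_signed a_assoc add.left_commute)
  qed
  finally show ?case .
qed

end

section \<open>Linear maps and alternating sums\<close>

lemma linear_mapI:
  assumes "\<And>x. x \<in> carrier M \<Longrightarrow> h x \<in> carrier N"
    and "\<And>x y. x \<in> carrier M \<Longrightarrow> y \<in> carrier M \<Longrightarrow> h (x \<oplus>\<^bsub>M\<^esub> y) = h x \<oplus>\<^bsub>N\<^esub> h y"
    and "\<And>a x. a \<in> carrier K \<Longrightarrow> x \<in> carrier M \<Longrightarrow> h (a \<odot>\<^bsub>M\<^esub> x) = a \<odot>\<^bsub>N\<^esub> h x"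
  shows "linear_map K M N h"
  using assms by (auto simp: linear_map_def)

lemma linear_map_closed: "linear_map K M N h \<Longrightarrow> x \<in> carrier M \<Longrightarrow> h x \<in> carrier N"
  by (auto simp: linear_map_def)

lemma linear_map_add:
  "linear_map K M N h \<Longrightarrow> x \<in> carrier M \<Longrightarrow> y \<in> carrier M \<Longrightarrow> h (x \<oplus>\<^bsub>M\<^esub> y) = h x \<oplus>\<^bsub>N\<^esub> h y"
  by (auto simp: linear_map_def)

lemma linear_map_comp:
  "linear_map K M N h \<Longrightarrow> linear_map K N P h' \<Longrightarrow> linear_map K M P (\<lambda>x. h' (h x))"
  by (auto simp: linear_map_def Pi_def)

lemma linear_map_signed:
  assumes "abelian_group M" "abelian_group N" and h: "linear_map K M N h" and x: "x \<in> carrier M"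
  shows "h (signed M e x) = signed N e (h x)"
proof -
  interpret M: abelian_group M by fact
  interpret N: abelian_group N by fact
  note cl = linear_map_closed[OF h]
  have "h \<zero>\<^bsub>M\<^esub> \<oplus>\<^bsub>N\<^esub> h \<zero>\<^bsub>M\<^esub> = h \<zero>\<^bsub>M\<^esub>"
    using linear_map_add[OF h M.zero_closed M.zero_closed] by simp
  then have "h \<zero>\<^bsub>M\<^esub> = \<zero>\<^bsub>N\<^esub>"
    using cl by (metis M.zero_closed N.add.r_cancel_one')
  then have "h (\<ominus>\<^bsub>M\<^esub> x) \<oplus>\<^bsub>N\<^esub> h x = \<zero>\<^bsub>N\<^esub>"
    using linear_map_add[OF h M.a_inv_closed[OF x] x] x by (simp add: M.l_neg)
  then have "h (\<ominus>\<^bsub>M\<^esub> x) = \<ominus>\<^bsub>N\<^esub> h x"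
    using cl x by (metis M.a_inv_closed N.minus_equality)
  then show ?thesis by (simp add: signed_def)
qed

lemma linear_map_alt_sum:
  assumes "abelian_group M" "abelian_group N" and h: "linear_map K M N h"
    and "\<And>k. k \<le> n \<Longrightarrow> x k \<in> carrier M"
  shows "h (alt_sum M n x) = alt_sum N n (\<lambda>k. h (x k))"
proof -
  interpret M: abelian_group M by fact
  interpret N: abelian_group N by fact
  note cl = linear_map_closed[OF h]
  show ?thesis using assms(4)
  proof (induction n)
    case 0
    then show ?case by (simp add: M.alt_sum_0 N.alt_sum_0 cl)
  next
    case (Suc n)
    then show ?case
      by (simp add: M.alt_sum_Suc N.alt_sum_Suc cl linear_map_add[OF h] M.alt_sum_closed
          linear_map_signed[OF assms(1-3)])
  qed
qed

lemma linear_map_alt_sum_maps: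
  assumes "module K M" "module K N" and "\<And>k. k \<le> n \<Longrightarrow> linear_map K M N (h k)"
  shows "linear_map K M N (\<lambda>x. alt_sum N n (\<lambda>k. h k x))"
proof -
  interpret M: module K M by fact
  interpret N: module K N by fact
  note h = assms(3)
  note cl = linear_map_closed[OF h]
  show ?thesis
  proof (rule linear_mapI)
    fix x y assume xy: "x \<in> carrier M" "y \<in> carrier M"
    have "alt_sum N n (\<lambda>k. h k (x \<oplus>\<^bsub>M\<^esub> y)) = alt_sum N n (\<lambda>k. h k x \<oplus>\<^bsub>N\<^esub> h k y)"
      using xy by (intro N.alt_sum_cong) (auto simp: cl linear_map_add[OF h])
    then show "alt_sum N n (\<lambda>k. h k (x \<oplus>\<^bsub>M\<^esub> y)) = alt_sum N n (\<lambda>k. h k x) \<oplus>\<^bsub>N\<^esub> alt_sum N n (\<lambda>k. h k y)"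
      using xy by (simp add: N.alt_sum_add cl)
  next
    fix a x assume ax: "a \<in> carrier K" "x \<in> carrier M"
    \<comment> \<open>Scaling by \<open>a\<close> is itself linear, as \<open>K\<close> is
      commutative, so \<open>linear_map_alt_sum\<close> carries the scalar into the sum.\<close>
    have "linear_map K N N (\<lambda>y. a \<odot>\<^bsub>N\<^esub> y)"
      using ax by (intro linear_mapI)
        (auto simp: N.smult_r_distr N.smult_assoc1[symmetric] M.R.m_comm)
    then have "a \<odot>\<^bsub>N\<^esub> alt_sum N n (\<lambda>k. h k x) = alt_sum N n (\<lambda>k. a \<odot>\<^bsub>N\<^esub> h k x)"
      using ax cl by (intro linear_map_alt_sum N.abelian_group_axioms) auto
    also have "\<dots> = alt_sum N n (\<lambda>k. h k (a \<odot>\<^bsub>M\<^esub> x))"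
    proof (intro N.alt_sum_cong)
      fix k assume k: "k \<le> n"
      show "a \<odot>\<^bsub>N\<^esub> h k x = h k (a \<odot>\<^bsub>M\<^esub> x)"
        using h[OF k] ax by (simp add: linear_map_def)
      show "h k (a \<odot>\<^bsub>M\<^esub> x) \<in> carrier N"
        using cl[OF k] ax by simp
    qed
    finally show "alt_sum N n (\<lambda>k. h k (a \<odot>\<^bsub>M\<^esub> x)) = a \<odot>\<^bsub>N\<^esub> alt_sum N n (\<lambda>k. h k x)" ..
  qed (auto intro!: N.alt_sum_closed cl)
qed

section \<open>Composition rules with flexible degrees\<close>

context weak_comp_algebra
begin

lemma abelian_group_V: "abelian_group (V n)"
  using vector_space[of n] by (simp add: module_def)

text \<open>Here and in the rules below, resulting degrees are variables tied by equations, so that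
  the rules also match degrees such as \<open>m + 1\<close> or \<open>3\<close> that do not
  literally read \<open>m + n - 1\<close>.\<close>

lemma comp_linear_right:
  "0 \<le> i \<Longrightarrow> f \<in> carrier (V m) \<Longrightarrow> q = m + n - 1 \<Longrightarrow> linear_map K (V n) (V q) (cmp m n i f)"
  using comp_bilinear[of i m n] by (auto simp: bilinear_map_def)

lemma comp_linear_left:
  "0 \<le> i \<Longrightarrow> g \<in> carrier (V n) \<Longrightarrow> q = m + n - 1 \<Longrightarrow>
    linear_map K (V m) (V q) (\<lambda>f. cmp m n i f g)"
  using comp_bilinear[of i m n] by (auto simp: bilinear_map_def)

lemma comp_closed [simp]:
  "0 \<le> i \<Longrightarrow> f \<in> carrier (V m) \<Longrightarrow> g \<in> carrier (V n) \<Longrightarrow> q = m + n - 1 \<Longrightarrow>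
    cmp m n i f g \<in> carrier (V q)"
  using linear_map_closed[OF comp_linear_right] by blast

lemma nested:
  assumes "f \<in> carrier (V m)" "g \<in> carrier (V n)" "h \<in> carrier (V p)"
    and "0 \<le> m" "0 \<le> n" "0 \<le> p" "0 \<le> i" "i \<le> j" "j < n + i"
    and "q = m + n - 1" "r = n + p - 1" "l = j - i"
  shows "cmp q p j (cmp m n i f g) h = cmp m r i f (cmp n p l g h)"
  using comp_nested[of m n p i f g h j] assms by simp

text \<open>Together with \<open>disjoint_pi_right\<close> this splits \<open>comp_disjoint\<close>
  by the position of \<pi>: here \<pi> is the factor inserted first, there the one inserted
  second.\<close>

lemma disjoint_pi_left:
  assumes "f \<in> carrier (V m)" "h \<in> carrier (V p)"
    and "0 \<le> m" "0 \<le> p" "0 \<le> j" "j < i"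
    and "q = m + 1" "r = m + p - 1" "l = i + p - 1"
  shows "cmp q p j (cmp m 2 i f \<pi>) h = cmp r 2 l (cmp m p j f h) \<pi>"
  using comp_disjoint[of m 2 p j f \<pi> h i] assms pi_closed by (simp add: add.commute)

lemma disjoint_pi_right:
  assumes "f \<in> carrier (V m)" "g \<in> carrier (V n)"
    and "0 \<le> m" "0 \<le> n" "0 \<le> j" "j < i"
    and "q = m + n - 1" "r = m + 1" "l = i + 1"
  shows "cmp q 2 j (cmp m n i f g) \<pi> = cmp r n l (cmp m 2 j f \<pi>) g"
  using comp_disjoint[of m n 2 j f g \<pi> i] assms pi_closed by (simp add: add.commute)

section \<open>Faces and the cosimplicial identities\<close>

definition face :: "int \<Rightarrow> int \<Rightarrow> 'v \<Rightarrow> 'v"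
  where "face m k f =
    (if k = 0 then cmp 2 m 1 \<pi> f else if k = m + 1 then cmp 2 m 0 \<pi> f else cmp m 2 (k - 1) f \<pi>)"

lemma face_linear: "0 \<le> k \<Longrightarrow> q = m + 1 \<Longrightarrow> linear_map K (V m) (V q) (face m k)"
  unfolding face_def using pi_closed
  by (cases "k = 0"; cases "k = m + 1") (auto intro!: comp_linear_left comp_linear_right)

lemma face_closed [simp]:
  "f \<in> carrier (V m) \<Longrightarrow> 0 \<le> k \<Longrightarrow> q = m + 1 \<Longrightarrow> face m k f \<in> carrier (V q)"
  using linear_map_closed[OF face_linear] by blast

text \<open>By \<open>pi_assoc\<close> the ternary element \<pi> composed with \<pi> can be read in
  two ways; this lemma and the next two insert \<open>f\<close> into its slots 2, 1 and 0. Slot 2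
  yields the identity for the faces \<open>i = 0\<close>, \<open>j = 1\<close>.\<close>

lemma pi1_pi1:
  assumes "0 \<le> m" "f \<in> carrier (V m)"
  shows "cmp (m + 1) 2 0 (cmp 2 m 1 \<pi> f) \<pi> = cmp 2 (m + 1) 1 \<pi> (cmp 2 m 1 \<pi> f)"
proof -
  have "cmp (m + 1) 2 0 (cmp 2 m 1 \<pi> f) \<pi> = cmp 3 m 2 (cmp 2 2 0 \<pi> \<pi>) f"
    using assms pi_closed by (intro disjoint_pi_right) auto
  also have "\<dots> = cmp 3 m 2 (cmp 2 2 1 \<pi> \<pi>) f"
    by (simp add: pi_assoc)
  also have "\<dots> = cmp 2 (m + 1) 1 \<pi> (cmp 2 m 1 \<pi> f)"
    using assms pi_closed by (intro nested) auto
  finally show ?thesis .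
qed

text \<open>With \<open>f\<close> in the middle slot both readings are plain nestings; this is the
  identity for the first and the last face, \<open>i = 0\<close>, \<open>j = m + 2\<close>.\<close>

lemma pi0_pi1:
  assumes "0 \<le> m" "f \<in> carrier (V m)"
  shows "cmp 2 (m + 1) 0 \<pi> (cmp 2 m 1 \<pi> f) = cmp 2 (m + 1) 1 \<pi> (cmp 2 m 0 \<pi> f)"
proof -
  have "cmp 2 (m + 1) 0 \<pi> (cmp 2 m 1 \<pi> f) = cmp 3 m 1 (cmp 2 2 0 \<pi> \<pi>) f"
    using assms pi_closed by (intro nested[symmetric]) auto
  also have "\<dots> = cmp 3 m 1 (cmp 2 2 1 \<pi> \<pi>) f"
    by (simp add: pi_assoc)
  also have "\<dots> = cmp 2 (m + 1) 1 \<pi> (cmp 2 m 0 \<pi> f)"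
    using assms pi_closed by (intro nested) auto
  finally show ?thesis .
qed

text \<open>Once \<open>f\<close> fills slot 0, the \<pi> at slot 1 moves to slot \<open>m\<close>;
  this is the identity for \<open>i = m + 1\<close>, \<open>j = m + 2\<close>.\<close>

lemma pi0_pi0:
  assumes "0 \<le> m" "f \<in> carrier (V m)"
  shows "cmp (m + 1) 2 m (cmp 2 m 0 \<pi> f) \<pi> = cmp 2 (m + 1) 0 \<pi> (cmp 2 m 0 \<pi> f)"
proof -
  have "cmp 2 (m + 1) 0 \<pi> (cmp 2 m 0 \<pi> f) = cmp 3 m 0 (cmp 2 2 0 \<pi> \<pi>) f"
    using assms pi_closed by (intro nested[symmetric]) auto
  also have "\<dots> = cmp 3 m 0 (cmp 2 2 1 \<pi> \<pi>) f"
    by (simp add: pi_assoc)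
  also have "\<dots> = cmp (m + 1) 2 m (cmp 2 m 0 \<pi> f) \<pi>"
    using assms pi_closed by (intro disjoint_pi_left) auto
  finally show ?thesis ..
qed

text \<open>An inner face and an outer one commute by nesting (cases 3 and 4). Two inner faces at
  different slots of \<open>f\<close> commute by disjointness (case 7); if the second acts on the
  \<pi> just inserted, \<open>pi_assoc\<close> applies (case 6). The remaining cases are the three
  identities above.\<close>

lemma face_face:
  assumes m: "0 \<le> m" and f: "f \<in> carrier (V m)" and ij: "0 \<le> i" "i < j" "j \<le> m + 2"
  shows "face (m + 1) j (face m i f) = face (m + 1) i (face m (j - 1) f)"
proof -
  consider "i = 0" "j = 1" | "i = 0" "j = m + 2" "j \<noteq> 1" | "i = 0" "1 < j" "j < m + 2"
    | "0 < i" "i \<le> m" "j = m + 2" | "i = m + 1" "j = m + 2" "0 < i"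
    | "0 < i" "j = i + 1" "j < m + 2" | "0 < i" "i + 1 < j" "j < m + 2"
    using m ij by (smt (verit))
  then show ?thesis
  proof cases
    case 1
    then show ?thesis using m f by (simp add: face_def pi1_pi1)
  next
    case 2
    then show ?thesis using m f by (simp add: face_def pi0_pi1)
  next
    case 3
    then have "cmp (m + 1) 2 (j - 1) (cmp 2 m 1 \<pi> f) \<pi> = cmp 2 (m + 1) 1 \<pi> (cmp m 2 (j - 2) f \<pi>)"
      using m f pi_closed by (intro nested) auto
    then show ?thesis using 3 by (simp add: face_def)
  next
    case 4
    then have "cmp (m + 1) 2 (i - 1) (cmp 2 m 0 \<pi> f) \<pi> = cmp 2 (m + 1) 0 \<pi> (cmp m 2 (i - 1) f \<pi>)"
      using m f pi_closed by (intro nested) auto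
    then show ?thesis using 4 by (simp add: face_def)
  next
    case 5
    then show ?thesis using m f by (simp add: face_def pi0_pi0)
  next
    case 6
    have "cmp (m + 1) 2 i (cmp m 2 (i - 1) f \<pi>) \<pi> = cmp m 3 (i - 1) f (cmp 2 2 1 \<pi> \<pi>)"
      using m f pi_closed 6 by (intro nested) auto
    also have "\<dots> = cmp m 3 (i - 1) f (cmp 2 2 0 \<pi> \<pi>)"
      by (simp add: pi_assoc)
    also have "\<dots> = cmp (m + 1) 2 (i - 1) (cmp m 2 (i - 1) f \<pi>) \<pi>"
      using m f pi_closed 6 by (intro nested[symmetric]) auto
    finally show ?thesis using 6 by (simp add: face_def)
  next
    case 7
    have "cmp (m + 1) 2 (i - 1) (cmp m 2 (j - 2) f \<pi>) \<pi>
        = cmp (m + 1) 2 (j - 1) (cmp m 2 (i - 1) f \<pi>) \<pi>"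
      using m f pi_closed 7 by (intro disjoint_pi_right) auto
    then show ?thesis using 7 by (simp add: face_def)
  qed
qed

section \<open>The coboundary and its square\<close>

text \<open>The factor (-1)^(n-1) turns the signs 1 and (-1)^(n-1) in \<open>diamond\<close> of
  \<pi> and \<open>f\<close> into (-1)^(n+1) for the last face and 1 for face 0. In
  \<open>diamond\<close> of \<open>f\<close> and \<pi>, slot \<open>i\<close> has sign (-1)^i and is
  face \<open>i + 1\<close>, so subtraction gives the required sign.\<close>

lemma coboundary_eq_alt_sum:
  assumes f: "f \<in> carrier (V (int n))"
  shows "coboundary V cmp \<pi> (int n) f = alt_sum (V (int n + 1)) (Suc n) (\<lambda>k. face (int n) (int k) f)"
proof -
  let ?M = "V (int n + 1)"
  interpret M: abelian_group ?M by (rule abelian_group_V)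
  let ?g = "\<lambda>k. face (int n) (int k) f"
  let ?x = "\<lambda>k. cmp (int n) 2 k f \<pi>"
  have g: "?g k \<in> carrier ?M" for k using f by simp
  have x: "?x (int k) \<in> carrier ?M" for k using f pi_closed by simp
  have pi: "cmp 2 (int n) 0 \<pi> f \<in> carrier ?M" "cmp 2 (int n) 1 \<pi> f \<in> carrier ?M"
    using f pi_closed by simp_all
  \<comment> \<open>The inner faces cancel against the sum for \<open>diamond\<close> of
    \<open>f\<close> and \<pi>, leaving face 0. The bound \<open>k \<le> n\<close> keeps the last
    face out, whose formula is different.\<close>
  have inner: "alt_sum ?M k ?g \<oplus>\<^bsub>?M\<^esub> (\<Oplus>\<^bsub>?M\<^esub>i\<in>{0..<int k}. signed ?M i (?x i)) = ?g 0"
    if "k \<le> n" for k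
    using that
  proof (induction k)
    case 0
    then show ?case using g[of 0] by (simp add: M.alt_sum_0)
  next
    case (Suc k)
    have S: "(\<Oplus>\<^bsub>?M\<^esub>i\<in>{0..<int k}. signed ?M i (?x i)) \<in> carrier ?M"
      using f pi_closed by (intro M.finsum_closed) auto
    have "{0..<int (Suc k)} = insert (int k) {0..<int k}" by auto
    then have "(\<Oplus>\<^bsub>?M\<^esub>i\<in>{0..<int (Suc k)}. signed ?M i (?x i))
        = signed ?M (int k) (?x (int k)) \<oplus>\<^bsub>?M\<^esub> (\<Oplus>\<^bsub>?M\<^esub>i\<in>{0..<int k}. signed ?M i (?x i))"
      using f pi_closed by (simp del: of_nat_Suc)
    moreover have "?g (Suc k) = ?x (int k)" using Suc.prems by (simp add: face_def)
    moreover have "alt_sum ?M (Suc k) ?g = alt_sum ?M k ?g \<oplus>\<^bsub>?M\<^esub> signed ?M (int (Suc k)) (?g (Suc k))"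
      using g by (intro M.alt_sum_Suc) auto
    moreover have "(a \<oplus>\<^bsub>?M\<^esub> signed ?M (int (Suc k)) y) \<oplus>\<^bsub>?M\<^esub> (signed ?M (int k) y \<oplus>\<^bsub>?M\<^esub> b) = a \<oplus>\<^bsub>?M\<^esub> b"
      if "a \<in> carrier ?M" "b \<in> carrier ?M" "y \<in> carrier ?M" for a b y
    proof -
      have "(a \<oplus>\<^bsub>?M\<^esub> signed ?M (int (Suc k)) y) \<oplus>\<^bsub>?M\<^esub> (signed ?M (int k) y \<oplus>\<^bsub>?M\<^esub> b)
          = a \<oplus>\<^bsub>?M\<^esub> ((signed ?M (int (Suc k)) y \<oplus>\<^bsub>?M\<^esub> signed ?M (int k) y) \<oplus>\<^bsub>?M\<^esub> b)"
        using that by (simp add: M.a_assoc)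
      also have "signed ?M (int (Suc k)) y \<oplus>\<^bsub>?M\<^esub> signed ?M (int k) y = \<zero>\<^bsub>?M\<^esub>"
        using that by (intro M.signed_cancel) auto
      finally show ?thesis using that by simp
    qed
    ultimately show ?case
      using Suc S x[of k] g by (simp add: M.alt_sum_closed del: of_nat_Suc)
  qed
  let ?S = "\<Oplus>\<^bsub>?M\<^esub>i\<in>{0..<int n}. signed ?M i (?x i)"
  have S: "?S \<in> carrier ?M" using f pi_closed by (intro M.finsum_closed) auto
  have alt: "alt_sum ?M n ?g \<in> carrier ?M" using g by auto
  have right: "diamond V cmp (int n) 2 f \<pi> = ?S"
    by (simp add: diamond_def atLeastLessThanPlusOne_atLeastAtMost_int[symmetric] add.commute)
  have "diamond V cmp 2 (int n) \<pi> f
      = (\<Oplus>\<^bsub>?M\<^esub>i\<in>{0, 1}. signed ?M (i * (int n - 1)) (cmp 2 (int n) i \<pi> f))"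
  proof -
    have "{0..2 - 1 :: int} = {0, 1}" "2 + int n - 1 = int n + 1" by auto
    then show ?thesis unfolding diamond_def by presburger
  qed
  also have "\<dots> = cmp 2 (int n) 0 \<pi> f \<oplus>\<^bsub>?M\<^esub> signed ?M (int n - 1) (cmp 2 (int n) 1 \<pi> f)"
    using pi by (simp add: Pi_def) (simp add: signed_def)
  finally have diamond_pi: "diamond V cmp 2 (int n) \<pi> f
      = cmp 2 (int n) 0 \<pi> f \<oplus>\<^bsub>?M\<^esub> signed ?M (int n - 1) (cmp 2 (int n) 1 \<pi> f)" .
  have left: "signed ?M (int n - 1) (diamond V cmp 2 (int n) \<pi> f)
      = signed ?M (int (Suc n)) (cmp 2 (int n) 0 \<pi> f) \<oplus>\<^bsub>?M\<^esub> cmp 2 (int n) 1 \<pi> f"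
    using pi unfolding diamond_pi by (simp add: M.signed_add M.signed_signed) (auto simp: signed_def)
  have "coboundary V cmp \<pi> (int n) f
     = signed ?M (int (Suc n)) (?g (Suc n)) \<oplus>\<^bsub>?M\<^esub> ?g 0 \<oplus>\<^bsub>?M\<^esub> \<ominus>\<^bsub>?M\<^esub> ?S"
    unfolding coboundary_def left right a_minus_def by (simp add: face_def add.commute)
  \<comment> \<open>Face 0 is traded for the partial alternating sum plus \<open>?S\<close>, and
    this \<open>?S\<close> cancels the subtracted one.\<close>
  also have "?g 0 = alt_sum ?M n ?g \<oplus>\<^bsub>?M\<^esub> ?S" using inner[of n] by simp
  also have "signed ?M (int (Suc n)) (?g (Suc n)) \<oplus>\<^bsub>?M\<^esub> (alt_sum ?M n ?g \<oplus>\<^bsub>?M\<^esub> ?S) \<oplus>\<^bsub>?M\<^esub> \<ominus>\<^bsub>?M\<^esub> ?S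
      = alt_sum ?M n ?g \<oplus>\<^bsub>?M\<^esub> signed ?M (int (Suc n)) (?g (Suc n))"
    using S alt g[of "Suc n"]
    by (simp add: M.a_assoc M.r_neg2 M.a_comm[OF alt] M.signed_closed del: of_nat_Suc)
  also have "\<dots> = alt_sum ?M (Suc n) ?g"
    using g by (intro M.alt_sum_Suc[symmetric]) auto
  finally show ?thesis .
qed

lemma coboundary_linear:
  assumes "0 \<le> m"
  shows "linear_map K (V m) (V (m + 1)) (coboundary V cmp \<pi> m)"
proof -
  obtain n where m: "m = int n" using assms zero_le_imp_eq_int by blast
  have "linear_map K (V m) (V (m + 1)) (\<lambda>f. alt_sum (V (m + 1)) (Suc n) (\<lambda>k. face m (int k) f))"
    by (intro linear_map_alt_sum_maps vector_space face_linear) auto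
  \<comment> \<open>The alternating-sum formula is known on the carrier only, so linearity is
    transferred pointwise, using that the carrier is closed under sums and scalars.\<close>
  then show ?thesis
    unfolding linear_map_def m
    using module.smult_closed[OF vector_space] abelian_monoid.a_closed[OF abelian_group.axioms(1)[OF abelian_group_V]]
    by (auto simp: coboundary_eq_alt_sum Pi_def)
qed

lemma cochain_complex_coboundary: "cochain_complex K V (coboundary V cmp \<pi>)"
  unfolding cochain_complex_def
proof (intro conjI allI impI ballI)
  fix m :: int and f assume m: "0 \<le> m" and f: "f \<in> carrier (V m)"
  obtain n where n: "m = int n" using m zero_le_imp_eq_int by blast
  interpret M: abelian_group "V (m + 2)" by (rule abelian_group_V)
  let ?d = "coboundary V cmp \<pi>"
  have s: "int (Suc n) = m + 1" by (simp add: n)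
  have "?d m f \<in> carrier (V (m + 1))"
    using f coboundary_linear[OF m] by (rule linear_map_closed[rotated])
  then have "?d (m + 1) (?d m f)
      = alt_sum (V (m + 2)) (Suc (Suc n)) (\<lambda>j. face (m + 1) (int j) (?d m f))"
    using coboundary_eq_alt_sum[of "?d m f" "Suc n"] by (simp add: s add.commute del: of_nat_Suc)
  \<comment> \<open>Each outer face is linear and passes into the inner sum, which gives the double
    sum that \<open>alt_sum_alt_sum_zero\<close> annihilates.\<close>
  also have "\<dots> = alt_sum (V (m + 2)) (Suc (Suc n))
      (\<lambda>j. alt_sum (V (m + 2)) (Suc n) (\<lambda>i. face (m + 1) (int j) (face m (int i) f)))"
  proof (intro M.alt_sum_cong)
    fix j
    have "?d m f = alt_sum (V (m + 1)) (Suc n) (\<lambda>k. face m (int k) f)"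
      using coboundary_eq_alt_sum[of f n] f n by simp
    then show "face (m + 1) (int j) (?d m f)
        = alt_sum (V (m + 2)) (Suc n) (\<lambda>i. face (m + 1) (int j) (face m (int i) f))"
      using f linear_map_alt_sum[OF abelian_group_V abelian_group_V
          face_linear[of "int j" "m + 2" "m + 1"], of "Suc n" "\<lambda>k. face m (int k) f"]
      by simp
  qed (use f in \<open>auto intro!: M.alt_sum_closed\<close>)
  also have "\<dots> = \<zero>\<^bsub>V (m + 2)\<^esub>"
  proof (intro M.alt_sum_alt_sum_zero)
    fix i j :: nat assume "i < j" "j \<le> Suc (Suc n)"
    \<comment> \<open>Since \<open>i < j\<close>, the natural subtraction \<open>j - 1\<close> is
      not truncated and agrees with the integer one.\<close>
    then show "face (m + 1) (int j) (face m (int i) f)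
        = face (m + 1) (int i) (face m (int (j - 1)) f)"
      using face_face[OF m f, of "int i" "int j"] n by (simp add: of_nat_diff)
  qed (use f in auto)
  finally show "?d (m + 1) (?d m f) = \<zero>\<^bsub>V (m + 2)\<^esub>" .
qed (rule coboundary_linear)

section \<open>The Leibniz rule\<close>

text \<open>Isolates what the two products share: \<open>left\<close> and \<open>right\<close>
  distribute the faces of a product over its factors, and \<open>middle\<close> identifies the two
  surplus terms that \<open>alt_sum_glue\<close> cancels.\<close>

lemma derivation_of_faces:
  assumes bil: "graded_algebra K V mlt"
    and left: "\<And>m n k f g. \<lbrakk>0 \<le> m; 0 \<le> n; 0 \<le> k; k \<le> m; f \<in> carrier (V m); g \<in> carrier (V n)\<rbrakk> \<Longrightarrow>
      face (m + n) k (mlt m n f g) = mlt (m + 1) n (face m k f) g"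
    and right: "\<And>m n k f g. \<lbrakk>0 \<le> m; 0 \<le> n; 1 \<le> k; k \<le> n + 1; f \<in> carrier (V m); g \<in> carrier (V n)\<rbrakk> \<Longrightarrow>
      face (m + n) (m + k) (mlt m n f g) = mlt m (n + 1) f (face n k g)"
    and middle: "\<And>m n f g. \<lbrakk>0 \<le> m; 0 \<le> n; f \<in> carrier (V m); g \<in> carrier (V n)\<rbrakk> \<Longrightarrow>
      mlt (m + 1) n (face m (m + 1) f) g = mlt m (n + 1) f (face n 0 g)"
  shows "degree_one_derivation K V mlt (coboundary V cmp \<pi>)"
  unfolding degree_one_derivation_def
proof (intro conjI allI impI ballI)
  fix m n :: int and f g
  assume m: "0 \<le> m" and n: "0 \<le> n" and f: "f \<in> carrier (V m)" and g: "g \<in> carrier (V n)"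
  obtain m' where m': "m = int m'" using m zero_le_imp_eq_int by blast
  obtain n' where n': "n = int n'" using n zero_le_imp_eq_int by blast
  let ?d = "coboundary V cmp \<pi>" and ?M = "V (m + n + 1)"
  interpret M: abelian_group ?M by (rule abelian_group_V)
  have bil_right: "linear_map K (V p) (V (m + p)) (mlt m p f)" if "0 \<le> p" for p
    using bil m f that by (simp add: graded_algebra_def bilinear_map_def)
  have bil_left: "linear_map K (V p) (V (p + n)) (\<lambda>x. mlt p n x g)" if "0 \<le> p" for p
    using bil n g that by (simp add: graded_algebra_def bilinear_map_def)
  have lin1: "linear_map K (V (m + 1)) ?M (\<lambda>x. mlt (m + 1) n x g)"
    using bil_left[of "m + 1"] m by (simp add: ac_simps)
  have lin2: "linear_map K (V (n + 1)) ?M (mlt m (n + 1) f)"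
    using bil_right[of "n + 1"] n by (simp add: ac_simps)
  have fg: "mlt m n f g \<in> carrier (V (m + n))"
    using linear_map_closed[OF bil_right[OF n] g] .
  have df: "mlt (m + 1) n (?d m f) g
      = alt_sum ?M (Suc m') (\<lambda>k. mlt (m + 1) n (face m (int k) f) g)"
    using coboundary_eq_alt_sum[of f m'] f m'
      linear_map_alt_sum[OF abelian_group_V abelian_group_V lin1, of "Suc m'" "\<lambda>k. face m (int k) f"]
    by simp
  have dg: "mlt m (n + 1) f (?d n g)
      = alt_sum ?M (Suc n') (\<lambda>k. mlt m (n + 1) f (face n (int k) g))"
    using coboundary_eq_alt_sum[of g n'] g n'
      linear_map_alt_sum[OF abelian_group_V abelian_group_V lin2, of "Suc n'" "\<lambda>k. face n (int k) g"]
    by simp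
  have "?d (m + n) (mlt m n f g) = alt_sum ?M (m' + Suc n') (\<lambda>k. face (m + n) (int k) (mlt m n f g))"
    using coboundary_eq_alt_sum[of "mlt m n f g" "m' + n'"] fg m' n' by simp
  \<comment> \<open>Both sums on the right are complete coboundaries: the first runs one face beyond
    those coming from \<open>left\<close>, the second starts one face before those coming from
    \<open>right\<close>.\<close>
  also have "\<dots> = alt_sum ?M (Suc m') (\<lambda>k. mlt (m + 1) n (face m (int k) f) g)
      \<oplus>\<^bsub>?M\<^esub> signed ?M (int m') (alt_sum ?M (Suc n') (\<lambda>k. mlt m (n + 1) f (face n (int k) g)))"
  proof (rule M.alt_sum_glue)
    fix k assume "k \<le> m'"
    then show "face (m + n) (int k) (mlt m n f g) = mlt (m + 1) n (face m (int k) f) g"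
      using m n f g m' by (intro left) auto
  next
    fix k :: nat assume "1 \<le> k" "k \<le> Suc n'"
    then show "face (m + n) (int (m' + k)) (mlt m n f g) = mlt m (n + 1) f (face n (int k) g)"
      using m n f g m' n' right[of m n "int k" f g] by simp
  next
    show "mlt (m + 1) n (face m (int (Suc m')) f) g = mlt m (n + 1) f (face n (int 0) g)"
      using middle[OF m n f g] m' by (simp add: add.commute)
  qed (use f g in \<open>auto intro!: linear_map_closed[OF lin1] linear_map_closed[OF lin2]\<close>)
  finally show "?d (m + n) (mlt m n f g)
      = mlt (m + 1) n (?d m f) g \<oplus>\<^bsub>?M\<^esub> signed ?M m (mlt m (n + 1) f (?d n g))"
    using df dg m' by simp
qed (rule coboundary_linear)

lemma graded_algebra_cup: "graded_algebra K V (cup cmp \<pi>)"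
  unfolding graded_algebra_def bilinear_map_def cup_def
proof (intro conjI allI impI ballI)
  fix m n :: int and f assume "0 \<le> m" "f \<in> carrier (V m)"
  then show "linear_map K (V n) (V (m + n)) (\<lambda>g. cmp (m + 1) n m (cmp 2 m 0 \<pi> f) g)"
    using pi_closed by (intro comp_linear_right) auto
next
  fix m n :: int and g assume "0 \<le> m" "g \<in> carrier (V n)"
  then show "linear_map K (V m) (V (m + n)) (\<lambda>f. cmp (m + 1) n m (cmp 2 m 0 \<pi> f) g)"
    using pi_closed
    by (intro linear_map_comp[OF comp_linear_right[of 0 \<pi> 2 "m + 1" m] comp_linear_left]) auto
qed

lemma graded_algebra_sqcup: "graded_algebra K V (sqcup cmp \<pi>)"
  unfolding graded_algebra_def bilinear_map_def sqcup_def
proof (intro conjI allI impI ballI)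
  fix m n :: int and f assume "f \<in> carrier (V m)"
  then show "linear_map K (V n) (V (m + n)) (\<lambda>g. cmp (n + 1) m 0 (cmp 2 n 1 \<pi> g) f)"
    using pi_closed
    by (intro linear_map_comp[OF comp_linear_right[of 1 \<pi> 2 "n + 1" n] comp_linear_left]) auto
next
  fix m n :: int and g assume "g \<in> carrier (V n)"
  then show "linear_map K (V m) (V (m + n)) (\<lambda>f. cmp (n + 1) m 0 (cmp 2 n 1 \<pi> g) f)"
    using pi_closed by (intro comp_linear_right) auto
qed

text \<open>The slots below \<open>m\<close> of \<open>cmp 2 m 0 \<pi> f\<close> are those of
  \<open>f\<close>, and slot \<open>m\<close> takes \<open>g\<close>. Hence inner faces of
  \<open>f\<close> must be moved past \<open>g\<close>, while inner faces of \<open>g\<close> are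
  nestings.\<close>

lemma derivation_cup: "degree_one_derivation K V (cup cmp \<pi>) (coboundary V cmp \<pi>)"
proof (rule derivation_of_faces[OF graded_algebra_cup])
  fix m n k :: int and f g
  assume m: "0 \<le> m" and n: "0 \<le> n" and k: "0 \<le> k" "k \<le> m"
    and f: "f \<in> carrier (V m)" and g: "g \<in> carrier (V n)"
  show "face (m + n) k (cup cmp \<pi> m n f g) = cup cmp \<pi> (m + 1) n (face m k f) g"
  proof (cases "k = 0")
    case True
    have "cmp 2 (m + n) 1 \<pi> (cmp (m + 1) n m (cmp 2 m 0 \<pi> f) g)
        = cmp (m + 2) n (m + 1) (cmp 2 (m + 1) 1 \<pi> (cmp 2 m 0 \<pi> f)) g"
      using m n f g pi_closed by (intro nested[symmetric]) auto
    then show ?thesis using True m f by (simp add: face_def cup_def pi0_pi1 add.assoc)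
  next
    case False
    have "cmp (m + n) 2 (k - 1) (cmp (m + 1) n m (cmp 2 m 0 \<pi> f) g) \<pi>
        = cmp (m + 2) n (m + 1) (cmp (m + 1) 2 (k - 1) (cmp 2 m 0 \<pi> f) \<pi>) g"
      using False m n k f g pi_closed by (intro disjoint_pi_right) auto
    also have "cmp (m + 1) 2 (k - 1) (cmp 2 m 0 \<pi> f) \<pi> = cmp 2 (m + 1) 0 \<pi> (cmp m 2 (k - 1) f \<pi>)"
      using False m k f pi_closed by (intro nested) auto
    finally show ?thesis using False k n by (simp add: face_def cup_def add.assoc)
  qed
next
  fix m n k :: int and f g
  assume m: "0 \<le> m" and n: "0 \<le> n" and k: "1 \<le> k" "k \<le> n + 1"
    and f: "f \<in> carrier (V m)" and g: "g \<in> carrier (V n)"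
  show "face (m + n) (m + k) (cup cmp \<pi> m n f g) = cup cmp \<pi> m (n + 1) f (face n k g)"
  proof (cases "k = n + 1")
    case True
    \<comment> \<open>The outer \<pi> is rebracketed by \<open>pi0_pi0\<close> so that it sits at
      slot \<open>m\<close>, directly around \<open>g\<close>. The middle identity below uses the
      same move with \<open>g\<close> in the other slot of that \<pi>.\<close>
    have "cmp 2 (m + n) 0 \<pi> (cmp (m + 1) n m (cmp 2 m 0 \<pi> f) g)
        = cmp (m + 2) n m (cmp 2 (m + 1) 0 \<pi> (cmp 2 m 0 \<pi> f)) g"
      using m n f g pi_closed by (intro nested[symmetric]) auto
    also have "\<dots> = cmp (m + 2) n m (cmp (m + 1) 2 m (cmp 2 m 0 \<pi> f) \<pi>) g"
      using m f by (simp add: pi0_pi0)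
    also have "\<dots> = cmp (m + 1) (n + 1) m (cmp 2 m 0 \<pi> f) (cmp 2 n 0 \<pi> g)"
      using m n f g pi_closed by (intro nested) auto
    finally show ?thesis using True m n by (simp add: face_def cup_def)
  next
    case False
    have "cmp (m + n) 2 (m + k - 1) (cmp (m + 1) n m (cmp 2 m 0 \<pi> f) g) \<pi>
        = cmp (m + 1) (n + 1) m (cmp 2 m 0 \<pi> f) (cmp n 2 (k - 1) g \<pi>)"
      using False m n k f g pi_closed by (intro nested) auto
    then show ?thesis using False k m by (simp add: face_def cup_def)
  qed
next
  fix m n :: int and f g
  assume m: "0 \<le> m" and n: "0 \<le> n" and f: "f \<in> carrier (V m)" and g: "g \<in> carrier (V n)"
  have "cmp (m + 2) n (m + 1) (cmp 2 (m + 1) 0 \<pi> (cmp 2 m 0 \<pi> f)) g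
      = cmp (m + 2) n (m + 1) (cmp (m + 1) 2 m (cmp 2 m 0 \<pi> f) \<pi>) g"
    using m f by (simp add: pi0_pi0)
  also have "\<dots> = cmp (m + 1) (n + 1) m (cmp 2 m 0 \<pi> f) (cmp 2 n 1 \<pi> g)"
    using m n f g pi_closed by (intro nested) auto
  finally show "cup cmp \<pi> (m + 1) n (face m (m + 1) f) g = cup cmp \<pi> m (n + 1) f (face n 0 g)"
    using m by (simp add: face_def cup_def add.assoc)
qed

text \<open>In \<open>cmp 2 n 1 \<pi> g\<close> slot 0 takes \<open>f\<close> and the later slots
  belong to \<open>g\<close>, so the roles are exchanged: inner faces of \<open>f\<close> are
  nestings, and those of \<open>g\<close> must be moved past \<open>f\<close>. The first face and
  the middle identity rest on \<open>pi1_pi1\<close>, the last face on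
  \<open>pi0_pi1\<close>.\<close>

lemma derivation_sqcup: "degree_one_derivation K V (sqcup cmp \<pi>) (coboundary V cmp \<pi>)"
proof (rule derivation_of_faces[OF graded_algebra_sqcup])
  fix m n k :: int and f g
  assume m: "0 \<le> m" and n: "0 \<le> n" and k: "0 \<le> k" "k \<le> m"
    and f: "f \<in> carrier (V m)" and g: "g \<in> carrier (V n)"
  show "face (m + n) k (sqcup cmp \<pi> m n f g) = sqcup cmp \<pi> (m + 1) n (face m k f) g"
  proof (cases "k = 0")
    case True
    have "cmp 2 (m + n) 1 \<pi> (cmp (n + 1) m 0 (cmp 2 n 1 \<pi> g) f)
        = cmp (n + 2) m 1 (cmp 2 (n + 1) 1 \<pi> (cmp 2 n 1 \<pi> g)) f"
      using m n f g pi_closed by (intro nested[symmetric]) auto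
    also have "\<dots> = cmp (n + 2) m 1 (cmp (n + 1) 2 0 (cmp 2 n 1 \<pi> g) \<pi>) f"
      using n g by (simp add: pi1_pi1)
    also have "\<dots> = cmp (n + 1) (m + 1) 0 (cmp 2 n 1 \<pi> g) (cmp 2 m 1 \<pi> f)"
      using m n f g pi_closed by (intro nested) auto
    finally show ?thesis using True by (simp add: face_def sqcup_def)
  next
    case False
    have "cmp (m + n) 2 (k - 1) (cmp (n + 1) m 0 (cmp 2 n 1 \<pi> g) f) \<pi>
        = cmp (n + 1) (m + 1) 0 (cmp 2 n 1 \<pi> g) (cmp m 2 (k - 1) f \<pi>)"
      using False m n k f g pi_closed by (intro nested) auto
    then show ?thesis using False k n by (simp add: face_def sqcup_def)
  qed
next
  fix m n k :: int and f g
  assume m: "0 \<le> m" and n: "0 \<le> n" and k: "1 \<le> k" "k \<le> n + 1"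
    and f: "f \<in> carrier (V m)" and g: "g \<in> carrier (V n)"
  show "face (m + n) (m + k) (sqcup cmp \<pi> m n f g) = sqcup cmp \<pi> m (n + 1) f (face n k g)"
  proof (cases "k = n + 1")
    case True
    have "cmp 2 (m + n) 0 \<pi> (cmp (n + 1) m 0 (cmp 2 n 1 \<pi> g) f)
        = cmp (n + 2) m 0 (cmp 2 (n + 1) 0 \<pi> (cmp 2 n 1 \<pi> g)) f"
      using m n f g pi_closed by (intro nested[symmetric]) auto
    then show ?thesis using True m n g by (simp add: face_def sqcup_def pi0_pi1 add.assoc)
  next
    case False
    \<comment> \<open>Filling slot 0 with \<open>f\<close> shifts later slots by
      \<open>m - 1\<close>, so slot \<open>m + k - 1\<close> is slot \<open>k\<close> before the
      insertion, that is slot \<open>k - 1\<close> of \<open>g\<close>.\<close>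
    have "cmp (m + n) 2 (m + k - 1) (cmp (n + 1) m 0 (cmp 2 n 1 \<pi> g) f) \<pi>
        = cmp (n + 2) m 0 (cmp (n + 1) 2 k (cmp 2 n 1 \<pi> g) \<pi>) f"
      using False m n k f g pi_closed by (intro disjoint_pi_left[symmetric]) auto
    also have "cmp (n + 1) 2 k (cmp 2 n 1 \<pi> g) \<pi> = cmp 2 (n + 1) 1 \<pi> (cmp n 2 (k - 1) g \<pi>)"
      using False n k g pi_closed by (intro nested) auto
    finally show ?thesis using False k m by (simp add: face_def sqcup_def add.assoc)
  qed
next
  fix m n :: int and f g
  assume m: "0 \<le> m" and n: "0 \<le> n" and f: "f \<in> carrier (V m)" and g: "g \<in> carrier (V n)"
  have "cmp (n + 1) (m + 1) 0 (cmp 2 n 1 \<pi> g) (cmp 2 m 0 \<pi> f)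
      = cmp (n + 2) m 0 (cmp (n + 1) 2 0 (cmp 2 n 1 \<pi> g) \<pi>) f"
    using m n f g pi_closed by (intro nested[symmetric]) auto
  also have "\<dots> = cmp (n + 2) m 0 (cmp 2 (n + 1) 1 \<pi> (cmp 2 n 1 \<pi> g)) f"
    using n g by (simp add: pi1_pi1)
  finally show "sqcup cmp \<pi> (m + 1) n (face m (m + 1) f) g = sqcup cmp \<pi> m (n + 1) f (face n 0 g)"
    using m by (simp add: face_def sqcup_def add.assoc)
qed

end

theorem proposition4p7:
  fixes K :: "('k, 'a) ring_scheme"
    and V :: "int \<Rightarrow> ('k, 'v, 'b) module_scheme"
    and cmp :: "int \<Rightarrow> int \<Rightarrow> int \<Rightarrow> 'v \<Rightarrow> 'v \<Rightarrow> 'v"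
    and \<pi> :: 'v
  assumes "weak_comp_algebra K V cmp \<pi>"
  shows "cochain_complex K V (coboundary V cmp \<pi>) \<and>
    graded_algebra K V (cup cmp \<pi>) \<and>
    degree_one_derivation K V (cup cmp \<pi>) (coboundary V cmp \<pi>) \<and>
    graded_algebra K V (sqcup cmp \<pi>) \<and>
    degree_one_derivation K V (sqcup cmp \<pi>) (coboundary V cmp \<pi>)"
proof -
  interpret weak_comp_algebra K V cmp \<pi> by fact
  show ?thesis
    by (intro conjI cochain_complex_coboundary graded_algebra_cup derivation_cup
        graded_algebra_sqcup derivation_sqcup)
qed

end
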